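(* If $m,n\ge 10$ are integers and $n\equiv 0\pmod 5$, then $$\gamma_R(P_m\Box C_n)=\frac{2(m+1)n}{5}.$$
   Context: A Roman dominating function of a graph $G$ is a function $f\colon V(G)\to\{0,1,2\}$ such that every vertex $v$ with $f(v)=0$ is adjacent to at least one vertex $w$ with $f(w)=2$. Its weight is $f(G)=\sum_{u\in V(G)}f(u)$, and the Roman domination number $\gamma_R(G)$ is the minimum weight of a Roman dominating function of $G$. $P_m$ is the path with $m$ vertices and $C_n$ is the cycle with $n$ vertices. The cylinder $P_m\Box C_n$ is their Cartesian product: vertex set $V(P_m)\times V(C_n)$, with $(u_1,v_1)$ and $(u_2,v_2)$ adjacent if and only if either $u_1=u_2$ and $v_1,v_2$ are adjacent in $C_n$, or $u_1,u_2$ are adjacent in $P_m$ and $v_1=v_2$. *)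

theory Defs
  imports Complex_Main "HOL-Library.FuncSet" "Graph_Theory.Pair_Digraph"
begin

text \<open>
  Finite simple graphs are represented as in \<^locale>\<open>pair_graph\<close>: an undirected edge between
  \<open>u\<close> and \<open>v\<close> is the pair of arcs \<open>(u, v)\<close> and \<open>(v, u)\<close>.
\<close>

definition path_graph :: "nat \<Rightarrow> nat pair_pre_digraph" where
  "path_graph m =
     \<lparr> pverts = {..<m},
       parcs = {(u, v). u < m \<and> v < m \<and> (v = Suc u \<or> u = Suc v)} \<rparr>"

text \<open>The following is the cycle only for \<open>n \<ge> 3\<close>.\<close>

definition cycle_graph :: "nat \<Rightarrow> nat pair_pre_digraph" where
  "cycle_graph n =
     \<lparr> pverts = {..<n},
       parcs = {(u, v). u < n \<and> v < n \<and> (v = Suc u mod n \<or> u = Suc v mod n)} \<rparr>"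

definition cartesian_product ::
    "'a pair_pre_digraph \<Rightarrow> 'b pair_pre_digraph \<Rightarrow> ('a \<times> 'b) pair_pre_digraph"
    (infixr \<open>\<box>\<close> 75) where
  "G \<box> H =
     \<lparr> pverts = pverts G \<times> pverts H,
       parcs = {((u1, v1), (u2, v2)).
                  (u1 \<in> pverts G \<and> u1 = u2 \<and> (v1, v2) \<in> parcs H) \<or>
                  ((u1, u2) \<in> parcs G \<and> v1 \<in> pverts H \<and> v1 = v2)} \<rparr>"

definition roman_dominating :: "'a pair_pre_digraph \<Rightarrow> ('a \<Rightarrow> nat) \<Rightarrow> bool" where
  "roman_dominating G f \<longleftrightarrow>
     f \<in> pverts G \<rightarrow> {0, 1, 2} \<and>
     (\<forall>v\<in>pverts G. f v = 0 \<longrightarrow> (\<exists>w\<in>pverts G. (v, w) \<in> parcs G \<and> f w = 2))"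

definition roman_weight :: "'a pair_pre_digraph \<Rightarrow> ('a \<Rightarrow> nat) \<Rightarrow> nat" where
  "roman_weight G f = (\<Sum>u\<in>pverts G. f u)"

definition roman_domination_number :: "'a pair_pre_digraph \<Rightarrow> nat" (\<open>\<gamma>\<^sub>R\<close>) where
  "\<gamma>\<^sub>R G = (LEAST k. \<exists>f. roman_dominating G f \<and> roman_weight G f = k)"

lemma roman_domination_number_attained:
  "\<exists>f. roman_dominating G f \<and> roman_weight G f = \<gamma>\<^sub>R G"
proof -
  have "roman_dominating G (\<lambda>_. 1)"
    by (simp add: roman_dominating_def)
  then have "\<exists>k f. roman_dominating G f \<and> roman_weight G f = k"
    by blast
  then show ?thesis
    unfolding roman_domination_number_def by (rule LeastI_ex)
qed

lemma roman_domination_number_le: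
  "roman_dominating G f \<Longrightarrow> \<gamma>\<^sub>R G \<le> roman_weight G f"
  unfolding roman_domination_number_def by (rule Least_le) blast

lemma pair_graphI:
  assumes "finite (pverts G)" "parcs G \<subseteq> pverts G \<times> pverts G"
    and "\<And>u v. (u, v) \<in> parcs G \<Longrightarrow> (v, u) \<in> parcs G"
    and "\<And>u. (u, u) \<notin> parcs G"
  shows "pair_graph G"
proof
  show "finite (parcs G)"
    using assms(1,2) by (meson finite_SigmaI finite_subset)
  show "symmetric (with_proj G)"
    using assms(3) by (auto simp: symmetric_def intro: symI)
  show "fst e \<noteq> snd e" if "e \<in> parcs G" for e
    using that assms(4) by (metis prod.collapse)
qed (use assms(1,2) in auto)

lemma pair_graph_path_graph: "pair_graph (path_graph m)"
  by (rule pair_graphI) (auto simp: path_graph_def)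

lemma pair_graph_cycle_graph:
  assumes "n \<ge> 2"
  shows "pair_graph (cycle_graph n)"
proof (rule pair_graphI)
  fix u
  have "u \<noteq> Suc u mod n" if "u < n"
    using that assms by (cases "Suc u = n") auto
  then show "(u, u) \<notin> parcs (cycle_graph n)"
    by (auto simp: cycle_graph_def)
qed (auto simp: cycle_graph_def)

lemma pair_graph_cartesian_product:
  assumes "pair_graph G" "pair_graph H"
  shows "pair_graph (G \<box> H)"
proof -
  interpret G: pair_graph G by fact
  interpret H: pair_graph H by fact
  show ?thesis
  proof (rule pair_graphI)
    show "finite (pverts (G \<box> H))"
      by (simp add: cartesian_product_def)
    show "parcs (G \<box> H) \<subseteq> pverts (G \<box> H) \<times> pverts (G \<box> H)"
      by (auto simp: cartesian_product_def dest: G.wellformed' H.wellformed')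
    show "(y, x) \<in> parcs (G \<box> H)" if "(x, y) \<in> parcs (G \<box> H)" for x y
      using that G.pair_sym_arcs H.pair_sym_arcs
      by (auto simp: cartesian_product_def symmetric_def dest: symD)
    show "(x, x) \<notin> parcs (G \<box> H)" for x
      using G.pair_no_loops[of "(fst x, fst x)"] H.pair_no_loops[of "(snd x, snd x)"]
      by (auto simp: cartesian_product_def)
  qed
qed

end

theory Submission
  imports Defs
begin

text \<open>
  Upper bound: put 2 on the cells \<open>(i, j)\<close> with \<open>j + 2 * i \<equiv> 0 (mod 5)\<close>, a perfect code of the
  infinite grid, and 1 on the cells of the two boundary rows that it leaves undominated.

  Lower bound: let a cell of value 2 cover its closed neighbourhood and a cell of value 1 itself, and
  let the loss of a cell be 3 if its value is 1, plus twice the excess of its multiplicity of coverage over 1.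
  Double counting gives \<open>5 * weight = 2 * m * n + (total loss) + 2 * (number of 2s in the boundary rows)\<close>,
  so it suffices that the four rows next to each boundary, including the boundary term, contribute
  at least \<open>n\<close>. Row 0 alone falls short of this only where certain configurations of 2s occur in rows
  0 and 1. Each of them forces loss in rows 1 to 3, at places that are disjoint for different
  configurations. After this loss is credited to row 0, the inequality holds column by column
  up to a telescoping potential.
\<close>

section \<open>The potential along the boundary row\<close>

text \<open>
  The potential at the edge between columns 1 and 2 of four consecutive columns, where \<open>u\<^sub>i\<close> and \<open>v\<^sub>i\<close>
  say that column \<open>i\<close> has a 2 in row 0 and in row 1. The nonzero values balance the following
  accounts (in half units of loss). A maximal run of column blocks covered alternately by a 2 in row 0
  and by a 2 in row 1 lacks 3/2 at each end in row 0 and 1/2 at each end in row 1, and the surplus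
  of the column separating two runs pays for the two adjacent ends.
\<close>

definition potential :: "bool \<Rightarrow> bool \<Rightarrow> bool \<Rightarrow> bool \<Rightarrow> bool \<Rightarrow> bool \<Rightarrow> bool \<Rightarrow> bool \<Rightarrow> int" where
  "potential u0 v0 u1 v1 u2 v2 u3 v3 =
    (if u1 \<and> u2 then 0
     else if u2 then (if v2 then -5 else if v0 \<and> \<not> u0 \<and> \<not> v1 then -3 else 1)
     else if u1 then (if v1 then 5 else if v3 \<and> \<not> u3 \<and> \<not> v2 then 3 else -1)
     else if u0 \<and> \<not> v0 \<and> u3 \<and> \<not> v3 then (if v1 \<and> v2 then 0 else if v1 then -1 else if v2 then 1 else -3)
     else if u0 \<and> v0 then (if u3 \<and> \<not> v3 then 3 else 1)
     else if u3 \<and> v3 then (if u0 then -3 else -1)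
     else if v2 then 1 else if v1 then -1 else if u0 then -3 else if u3 then 3 else 0)"

text \<open>
  The credits 6, 2, 4, 2, 4 belong to the shapes \<open>gap3\<close>, \<open>pair\<close>, \<open>vee\<close>, \<open>gap4\<close>, \<open>stack\<close> below.
\<close>

lemma potential_step:
  assumes "u1 \<or> u2 \<or> u3 \<or> v2 \<or> s"
  shows "potential u1 v1 u2 v2 u3 v3 u4 v4 - potential u0 v0 u1 v1 u2 v2 u3 v3
    \<le> 2 * (3 * of_bool s + 2 * (of_bool u1 + of_bool u2 + of_bool u3 + of_bool v2 + of_bool s - 1)
        + 2 * of_bool u2 - 1)
      + 6 * of_bool (u0 \<and> u3 \<and> \<not> u1 \<and> \<not> u2 \<and> \<not> v0 \<and> \<not> v1 \<and> \<not> v2 \<and> \<not> v3)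
      + 2 * of_bool (v2 \<and> v3 \<and> \<not> u2 \<and> \<not> u3)
      + 4 * of_bool (v0 \<and> u2 \<and> v4 \<and> \<not> u0 \<and> \<not> u4 \<and> \<not> v1 \<and> \<not> v2 \<and> \<not> v3)
      + 2 * of_bool (u0 \<and> u4 \<and> \<not> u1 \<and> \<not> u2 \<and> \<not> u3 \<and> \<not> v0 \<and> \<not> v1 \<and> \<not> v2 \<and> \<not> v3 \<and> \<not> v4)
      + 4 * of_bool (u2 \<and> v2)"
  using assms
  by (cases u0; cases u1; cases u2; cases u3; cases u4; cases v0; cases v1; cases v2; cases v3; cases v4;
      simp add: potential_def)

section \<open>Strips of rows along a boundary: coverage, loss and shapes\<close>

lemma sum_periodic_shift:
  fixes F :: "int \<Rightarrow> 'a::comm_monoid_add" and n k :: int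
  assumes "n > 0" and per: "\<And>j. F (j mod n) = F j"
  shows "(\<Sum>j\<in>{0..<n}. F (j + k)) = (\<Sum>j\<in>{0..<n}. F j)"
proof (rule sum.reindex_bij_witness[where i = "\<lambda>j. (j - k) mod n" and j = "\<lambda>j. (j + k) mod n"])
  fix j assume "j \<in> {0..<n}"
  then show "((j + k) mod n - k) mod n = j" "((j - k) mod n + k) mod n = j"
    by (simp_all add: mod_simps)
  show "F ((j + k) mod n) = F (j + k)"
    by (rule per)
qed (use \<open>n > 0\<close> in auto)

text \<open>Natural subtraction sends \<open>0 - 1\<close> to 0; the guard \<open>0 < i\<close>
  keeps row 0 from counting as its own upper neighbour.\<close>

definition cover :: "(nat \<Rightarrow> int \<Rightarrow> bool) \<Rightarrow> (nat \<Rightarrow> int \<Rightarrow> bool) \<Rightarrow> nat \<Rightarrow> int \<Rightarrow> int" where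
  "cover T S i j = of_bool (T i (j - 1)) + of_bool (T i j) + of_bool (T i (j + 1)) + of_bool (T (Suc i) j)
     + of_bool (0 < i \<and> T (i - 1) j) + of_bool (S i j)"

definition loss :: "(nat \<Rightarrow> int \<Rightarrow> bool) \<Rightarrow> (nat \<Rightarrow> int \<Rightarrow> bool) \<Rightarrow> nat \<Rightarrow> int \<Rightarrow> int" where
  "loss T S i j = 3 * of_bool (S i j) + 2 * (cover T S i j - 1)"

text \<open>
  \<open>T i j\<close> and \<open>S i j\<close> say that the value in row \<open>i\<close> and column \<open>j\<close> is 2 and 1, respectively; row 0 is
  the boundary, and columns are integers so that the cycle becomes periodicity.
\<close>

locale boundary_strip =
  fixes T S :: "nat \<Rightarrow> int \<Rightarrow> bool" and n :: int
  assumes n_pos: "n > 0"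
    and T_mod: "T i (j mod n) = T i j" and S_mod: "S i (j mod n) = S i j"
    and cover_pos: "i < 4 \<Longrightarrow> cover T S i j \<ge> 1"
begin

definition inner_loss :: "int \<Rightarrow> int" where
  "inner_loss j = loss T S 1 j + loss T S 2 j + loss T S 3 j"

definition gap3 :: "int \<Rightarrow> bool" where
  "gap3 j \<longleftrightarrow> T 0 j \<and> T 0 (j + 3) \<and> \<not> T 0 (j + 1) \<and> \<not> T 0 (j + 2)
     \<and> \<not> T 1 j \<and> \<not> T 1 (j + 1) \<and> \<not> T 1 (j + 2) \<and> \<not> T 1 (j + 3)"

definition gap4 :: "int \<Rightarrow> bool" where
  "gap4 j \<longleftrightarrow> T 0 j \<and> T 0 (j + 4) \<and> \<not> T 0 (j + 1) \<and> \<not> T 0 (j + 2) \<and> \<not> T 0 (j + 3)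
     \<and> \<not> T 1 j \<and> \<not> T 1 (j + 1) \<and> \<not> T 1 (j + 2) \<and> \<not> T 1 (j + 3) \<and> \<not> T 1 (j + 4)"

text \<open>Alternating 2s in rows 0 and 1, two columns apart, cover row 0 without loss but give
  every four columns only the boundary term 2; the missing 2 is the credit 4 in half units.\<close>

definition vee :: "int \<Rightarrow> bool" where
  "vee j \<longleftrightarrow> T 1 j \<and> T 0 (j + 2) \<and> T 1 (j + 4) \<and> \<not> T 0 j \<and> \<not> T 0 (j + 4)
     \<and> \<not> T 1 (j + 1) \<and> \<not> T 1 (j + 2) \<and> \<not> T 1 (j + 3)"

text \<open>Where row 0 is covered only by a run of 2s in row 1, each column is short by 1, which is
  the credit 2 in half units.\<close>

definition pair :: "int \<Rightarrow> bool" where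
  "pair j \<longleftrightarrow> T 1 j \<and> T 1 (j + 1) \<and> \<not> T 0 j \<and> \<not> T 0 (j + 1)"

definition stack :: "int \<Rightarrow> bool" where
  "stack j \<longleftrightarrow> T 0 j \<and> T 1 j"

lemmas shape_defs = gap3_def gap4_def vee_def pair_def stack_def

lemma loss_nonneg: "i < 4 \<Longrightarrow> loss T S i j \<ge> 0"
  using cover_pos[of i j] by (simp add: loss_def)

lemma inner_loss_nonneg: "inner_loss j \<ge> 0"
  unfolding inner_loss_def using loss_nonneg[of 1 j] loss_nonneg[of 2 j] loss_nonneg[of 3 j] by simp

lemma loss_le_inner_loss:
  "loss T S 1 j \<le> inner_loss j" "loss T S 2 j \<le> inner_loss j" "loss T S 3 j \<le> inner_loss j"
  unfolding inner_loss_def using loss_nonneg[of 1 j] loss_nonneg[of 2 j] loss_nonneg[of 3 j] by simp_all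

lemma loss_single:
  assumes "i < 4" "S i j" shows "loss T S i j \<ge> 3"
  using cover_pos[OF assms(1), of j] assms(2) by (simp add: loss_def)

lemma loss1: "loss T S 1 j = 5 * of_bool (S 1 j)
     + 2 * (of_bool (T 1 (j - 1)) + of_bool (T 1 j) + of_bool (T 1 (j + 1)) + of_bool (T 2 j) + of_bool (T 0 j) - 1)"
  and loss2: "loss T S 2 j = 5 * of_bool (S 2 j)
     + 2 * (of_bool (T 2 (j - 1)) + of_bool (T 2 j) + of_bool (T 2 (j + 1)) + of_bool (T 3 j) + of_bool (T 1 j) - 1)"
  and loss3: "loss T S 3 j = 5 * of_bool (S 3 j)
     + 2 * (of_bool (T 3 (j - 1)) + of_bool (T 3 j) + of_bool (T 3 (j + 1)) + of_bool (T 4 j) + of_bool (T 2 j) - 1)"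
  by (simp_all add: loss_def cover_def numeral_eq_Suc)

lemma covered1: "S 1 j \<or> T 1 (j - 1) \<or> T 1 j \<or> T 1 (j + 1) \<or> T 2 j \<or> T 0 j"
  and covered2: "S 2 j \<or> T 2 (j - 1) \<or> T 2 j \<or> T 2 (j + 1) \<or> T 3 j \<or> T 1 j"
  using loss_nonneg[of 1 j] loss_nonneg[of 2 j] unfolding loss1 loss2
  by (auto simp: of_bool_def split: if_splits)

declare One_nat_def [simp del]

section \<open>Loss forced in rows 1 to 3 by each shape\<close>

text \<open>The cell in row 1 is covered by itself and by the 2 above it.\<close>

lemma stack_inner_loss:
  assumes "stack j"
  shows "inner_loss j \<ge> 2"
proof -
  have "loss T S 1 j \<ge> 2"
    using assms by (simp add: stack_def loss1)
  then show ?thesis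
    using loss_le_inner_loss(1)[of j] by simp
qed

text \<open>The two adjacent 2s cover each other.\<close>

lemma pair_inner_loss:
  assumes "pair j"
  shows "inner_loss j + inner_loss (j + 1) \<ge> 4"
proof -
  have "loss T S 1 j \<ge> 2" "loss T S 1 (j + 1) \<ge> 2"
    using assms by (simp_all add: pair_def loss1)
  then show ?thesis
    using loss_le_inner_loss(1)[of j] loss_le_inner_loss(1)[of "j + 1"] by simp
qed

text \<open>No 2 of row 0 or 1 reaches row 1 in columns \<open>j + 1\<close> and
  \<open>j + 2\<close>. If one of these cells has value 1, it alone loses 3; otherwise both lie
  above 2s of row 2, which cover each other.\<close>

lemma gap_inner_loss:
  assumes g: "T 0 j" "\<not> T 0 (j + 1)" "\<not> T 0 (j + 2)"
    "\<not> T 1 j" "\<not> T 1 (j + 1)" "\<not> T 1 (j + 2)" "\<not> T 1 (j + 3)"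
  shows "inner_loss (j + 1) + inner_loss (j + 2) \<ge> 3"
proof -
  note le = inner_loss_nonneg[of "j + 1"] inner_loss_nonneg[of "j + 2"]
  consider "S 1 (j + 1)" | "S 1 (j + 2)" | "\<not> S 1 (j + 1)" "\<not> S 1 (j + 2)" by blast
  then show ?thesis
  proof cases
    case 1
    then show ?thesis
      using loss_single[of 1 "j + 1"] loss_le_inner_loss(1)[of "j + 1"] le by simp
  next
    case 2
    then show ?thesis
      using loss_single[of 1 "j + 2"] loss_le_inner_loss(1)[of "j + 2"] le by simp
  next
    case 3
    then have "T 2 (j + 1)" "T 2 (j + 2)"
      using covered1[of "j + 1"] covered1[of "j + 2"] g by (auto simp: add.commute[of _ j])
    then have "loss T S 2 (j + 1) \<ge> 2" "loss T S 2 (j + 2) \<ge> 2"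
      by (simp_all add: loss2 add.commute[of _ j])
    then show ?thesis
      using loss_le_inner_loss(2)[of "j + 1"] loss_le_inner_loss(2)[of "j + 2"] by linarith
  qed
qed

lemma gap3_inner_loss: "gap3 j \<Longrightarrow> inner_loss (j + 1) + inner_loss (j + 2) \<ge> 3"
  by (rule gap_inner_loss) (simp_all add: gap3_def)

text \<open>The argument yields 3, but the credit 2 in half units asks only for 1.\<close>

lemma gap4_inner_loss: "gap4 j \<Longrightarrow> inner_loss (j + 1) + inner_loss (j + 2) + inner_loss (j + 3) \<ge> 1"
  using gap_inner_loss[of j] inner_loss_nonneg[of "j + 3"] by (simp add: gap4_def)

text \<open>The shape already covers row 1 in all five columns, so a 2 below it in row 2 causes
  excess, at an end column in both rows. If row 2 has no such 2 and no 1 in the middle columns,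
  three adjacent 2s in row 3 must cover these. The end columns have weight 1 because
  \<open>vee j\<close> and \<open>vee (j + 4)\<close> share one.\<close>

lemma vee_inner_loss:
  assumes v: "vee j"
  shows "inner_loss j + 2 * (inner_loss (j + 1) + inner_loss (j + 2) + inner_loss (j + 3)) + inner_loss (j + 4) \<ge> 4"
proof -
  note le = inner_loss_nonneg[of j] inner_loss_nonneg[of "j + 1"] inner_loss_nonneg[of "j + 2"]
    inner_loss_nonneg[of "j + 3"] inner_loss_nonneg[of "j + 4"]
  consider k where "k \<in> {1, 2, 3}" "S 2 (j + k) \<or> T 2 (j + k)"
    | k where "k \<in> {0, 4}" "T 2 (j + k)"
    | "\<not> T 2 j" "\<not> T 2 (j + 4)" "\<And>k. k \<in> {1, 2, 3} \<Longrightarrow> \<not> S 2 (j + k) \<and> \<not> T 2 (j + k)"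
    by (metis add.right_neutral insertCI)
  then show ?thesis
  proof cases
    case 1
    have "inner_loss (j + k) \<ge> 2"
      using 1(2)
    proof
      assume "S 2 (j + k)"
      then show ?thesis
        using loss_single[of 2 "j + k"] loss_le_inner_loss(2)[of "j + k"] by simp
    next
      assume "T 2 (j + k)"
      then have "loss T S 1 (j + k) \<ge> 2"
        using 1(1) v by (auto simp: vee_def loss1 add.commute[of _ j])
      then show ?thesis
        using loss_le_inner_loss(1)[of "j + k"] by linarith
    qed
    then show ?thesis
      using 1(1) le by auto
  next
    case 2
    then have "loss T S 1 (j + k) \<ge> 2" "loss T S 2 (j + k) \<ge> 2"
      using v by (auto simp: vee_def loss1 loss2 add.commute[of _ j])
    then have "inner_loss (j + k) \<ge> 4"
      using loss_nonneg[of 3 "j + k"] by (simp add: inner_loss_def)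
    then show ?thesis
      using 2(1) le by auto
  next
    case 3
    then have "T 3 (j + 1)" "T 3 (j + 2)" "T 3 (j + 3)"
      using covered2[of "j + 1"] covered2[of "j + 2"] covered2[of "j + 3"] 3(3)[of 1] 3(3)[of 2] 3(3)[of 3] v
      by (auto simp: vee_def add.commute[of _ j])
    then have "loss T S 3 (j + 2) \<ge> 4"
      by (simp add: loss3 add.commute[of _ j])
    then show ?thesis
      using loss_le_inner_loss(3)[of "j + 2"] le by simp
  qed
qed

section \<open>Paying the credits out of the inner loss and summing around the cycle\<close>

text \<open>
  The coefficients are the (doubled) shares of \<open>inner_loss j\<close> that the shapes near column \<open>j\<close> claim.
\<close>

lemma shape_disjoint:
  "2 * of_bool (gap3 (j - 1)) + 2 * of_bool (gap3 (j - 2))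
   + 2 * of_bool (gap4 (j - 1)) + 2 * of_bool (gap4 (j - 2)) + 2 * of_bool (gap4 (j - 3))
   + of_bool (vee j) + 2 * of_bool (vee (j - 1)) + 2 * of_bool (vee (j - 2)) + 2 * of_bool (vee (j - 3))
   + of_bool (vee (j - 4)) + of_bool (pair j) + of_bool (pair (j - 1)) + 2 * of_bool (stack j) \<le> (2::int)"
proof -
  have nf: "j - 1 + 1 = j" "j - 1 + 2 = j + 1" "j - 1 + 3 = j + 2" "j - 1 + 4 = j + 3"
     "j - 2 + 1 = j - 1" "j - 2 + 2 = j" "j - 2 + 3 = j + 1" "j - 2 + 4 = j + 2"
     "j - 3 + 1 = j - 2" "j - 3 + 2 = j - 1" "j - 3 + 3 = j" "j - 3 + 4 = j + 1"
     "j - 4 + 1 = j - 3" "j - 4 + 2 = j - 2" "j - 4 + 3 = j - 1" "j - 4 + 4 = j"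
    by simp_all
  show ?thesis
    unfolding shape_defs nf
    by (cases "T 0 j"; cases "T 1 j"; cases "T 1 (j + 1)"; cases "T 1 (j - 1)"; cases "T 0 (j + 1)"; cases "T 0 (j - 1)"; simp)
qed

lemma periodic_shift:
  assumes "\<And>j. F (j mod n) = F j"
  shows "F (j mod n + k) = F (j + k)" "F (j mod n - k) = F (j - k)"
  using assms[of "j mod n + k"] assms[of "j + k"] assms[of "j mod n - k"] assms[of "j - k"]
  by (simp_all add: mod_simps)

lemmas T_shift = periodic_shift[of "T i" for i, OF T_mod]

lemma inner_loss_mod: "inner_loss (j mod n) = inner_loss j"
  unfolding inner_loss_def loss1 loss2 loss3 by (simp add: T_shift T_mod S_mod)

lemma shape_mod:
  "gap3 (j mod n) = gap3 j" "gap4 (j mod n) = gap4 j" "vee (j mod n) = vee j"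
  "pair (j mod n) = pair j" "stack (j mod n) = stack j"
  unfolding shape_defs by (simp_all add: T_shift T_mod)

lemma sum_shift:
  assumes "\<And>j. F (j mod n) = F j"
  shows "(\<Sum>j\<in>{0..<n}. F (j + k)) = (\<Sum>j\<in>{0..<n}. (F j :: int))"
    and "(\<Sum>j\<in>{0..<n}. F (j - k)) = (\<Sum>j\<in>{0..<n}. F j)"
  using sum_periodic_shift[OF n_pos, of F k] sum_periodic_shift[OF n_pos, of F "- k"] assms by simp_all

text \<open>Regroups a charge by the column that pays it instead of the column where the shape
  starts.\<close>

lemma sum_inner_loss_shift:
  assumes "\<And>j. P (j mod n) = P j"
  shows "(\<Sum>j\<in>{0..<n}. of_bool (P j) * inner_loss (j + k))
    = (\<Sum>j\<in>{0..<n}. of_bool (P (j - k)) * inner_loss j)"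
  using sum_shift(1)[of "\<lambda>j. of_bool (P (j - k)) * inner_loss j" k]
  by (simp add: inner_loss_mod periodic_shift[of P, OF assms])

text \<open>Each credit is at most the weighted loss that its shape forces, and
  \<open>shape_disjoint\<close> keeps the claims on each column within 2.\<close>

lemma sum_inner_loss:
  "(\<Sum>j\<in>{0..<n}. 6 * of_bool (gap3 j) + 2 * of_bool (gap4 j) + 4 * of_bool (vee j)
      + 2 * of_bool (pair j) + 4 * of_bool (stack j)) \<le> 2 * (\<Sum>j\<in>{0..<n}. inner_loss j)"
proof -
  let ?I = inner_loss
  have "(\<Sum>j\<in>{0..<n}. 6 * of_bool (gap3 j) + 2 * of_bool (gap4 j) + 4 * of_bool (vee j)
      + 2 * of_bool (pair j) + 4 * of_bool (stack j))
    \<le> (\<Sum>j\<in>{0..<n}. of_bool (gap3 j) * (2 * (?I (j + 1) + ?I (j + 2)))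
        + of_bool (gap4 j) * (2 * (?I (j + 1) + ?I (j + 2) + ?I (j + 3)))
        + of_bool (vee j) * (?I j + 2 * (?I (j + 1) + ?I (j + 2) + ?I (j + 3)) + ?I (j + 4))
        + of_bool (pair j) * (?I j + ?I (j + 1))
        + of_bool (stack j) * (2 * ?I j))"
    (is "_ \<le> ?charged")
    using gap3_inner_loss gap4_inner_loss vee_inner_loss pair_inner_loss stack_inner_loss
    by (intro sum_mono add_mono) (auto simp: of_bool_def, fastforce+)
  also have "?charged = (\<Sum>j\<in>{0..<n}. (2 * of_bool (gap3 (j - 1)) + 2 * of_bool (gap3 (j - 2))
      + 2 * of_bool (gap4 (j - 1)) + 2 * of_bool (gap4 (j - 2)) + 2 * of_bool (gap4 (j - 3))
      + of_bool (vee j) + 2 * of_bool (vee (j - 1)) + 2 * of_bool (vee (j - 2)) + 2 * of_bool (vee (j - 3))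
      + of_bool (vee (j - 4)) + of_bool (pair j) + of_bool (pair (j - 1)) + 2 * of_bool (stack j)) * ?I j)"
    by (simp only: distrib_left distrib_right sum.distrib mult.left_commute[of _ 2] mult.assoc
        sum_distrib_left[symmetric] sum_inner_loss_shift shape_mod)
  also have "\<dots> \<le> (\<Sum>j\<in>{0..<n}. 2 * ?I j)"
    by (intro sum_mono mult_right_mono shape_disjoint inner_loss_nonneg)
  finally show ?thesis
    by (simp add: sum_distrib_left)
qed

lemma strip_loss:
  "n \<le> (\<Sum>j\<in>{0..<n}. (\<Sum>i<4. loss T S i j) + 2 * of_bool (T 0 j))"
proof -
  define \<phi> where "\<phi> j = potential (T 0 (j - 1)) (T 1 (j - 1)) (T 0 j) (T 1 j)
    (T 0 (j + 1)) (T 1 (j + 1)) (T 0 (j + 2)) (T 1 (j + 2))" for j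
  have \<phi>_mod: "\<phi> (j mod n) = \<phi> j" for j
    by (simp add: \<phi>_def T_shift T_mod)
  \<comment> \<open>In \<open>potential_step\<close>, read with column 2 as \<open>j\<close>, the
    shapes in \<open>G\<close> start in column \<open>j - 2\<close> and those in \<open>H\<close> in
    column \<open>j\<close>.\<close>
  define G where "G j = 6 * of_bool (gap3 j) + 4 * of_bool (vee j) + (2 * of_bool (gap4 j) :: int)" for j
  define H where "H j = 2 * of_bool (pair j) + (4 * of_bool (stack j) :: int)" for j
  have G_mod: "G (j mod n) = G j" for j
    by (simp add: G_def shape_mod)
  have nf: "j - 1 - 1 = j - 2" "j - 1 + 1 = j" "j - 1 + 2 = j + 1"
    "j - 2 + 1 = j - 1" "j - 2 + 2 = j" "j - 2 + 3 = j + 1" "j - 2 + 4 = j + 2" for j :: int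
    by simp_all
  have step: "\<phi> j - \<phi> (j - 1) \<le> 2 * (loss T S 0 j + 2 * of_bool (T 0 j) - 1) + G (j - 2) + H j" for j
  proof -
    have "T 0 (j - 1) \<or> T 0 j \<or> T 0 (j + 1) \<or> T 1 j \<or> S 0 j"
      using cover_pos[of 0 j] by (auto simp: cover_def One_nat_def of_bool_def split: if_splits)
    from potential_step[OF this, of "T 1 (j - 1)" "T 1 (j + 1)" "T 0 (j + 2)" "T 1 (j + 2)" "T 0 (j - 2)" "T 1 (j - 2)"]
    show ?thesis
      unfolding \<phi>_def G_def H_def shape_defs nf loss_def cover_def
      by (simp add: One_nat_def conj_ac)
  qed
  \<comment> \<open>By periodicity the potential differences cancel around the cycle.\<close>
  have "0 = (\<Sum>j\<in>{0..<n}. \<phi> j - \<phi> (j - 1))"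
    by (simp add: sum_subtractf sum_shift(2)[of \<phi>, OF \<phi>_mod])
  also have "\<dots> \<le> (\<Sum>j\<in>{0..<n}. 2 * (loss T S 0 j + 2 * of_bool (T 0 j) - 1) + G (j - 2) + H j)"
    by (intro sum_mono step)
  also have "\<dots> = 2 * (\<Sum>j\<in>{0..<n}. loss T S 0 j + 2 * of_bool (T 0 j)) - 2 * n + (\<Sum>j\<in>{0..<n}. G j + H j)"
    using n_pos by (simp add: sum.distrib sum_subtractf sum_shift(2)[of G, OF G_mod] algebra_simps
        flip: sum_distrib_left)
  also have "(\<Sum>j\<in>{0..<n}. G j + H j) \<le> 2 * (\<Sum>j\<in>{0..<n}. inner_loss j)"
    using sum_inner_loss by (simp add: G_def H_def add_ac)
  finally have "n \<le> (\<Sum>j\<in>{0..<n}. (loss T S 0 j + 2 * of_bool (T 0 j)) + inner_loss j)"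
    by (simp add: sum.distrib)
  also have "\<dots> = (\<Sum>j\<in>{0..<n}. (\<Sum>i<4. loss T S i j) + 2 * of_bool (T 0 j))"
    by (intro sum.cong) (simp_all add: inner_loss_def numeral_eq_Suc One_nat_def)
  finally show ?thesis .
qed

end

section \<open>Lower bound for the cylinder\<close>

lemma sum_lessThan_int:
  "(\<Sum>j\<in>{0..<int n}. F (nat j)) = (\<Sum>k<n. F k)"
  by (rule sum.reindex_bij_witness[where i = int and j = nat]) auto

lemma pverts_cylinder [simp]: "pverts (path_graph m \<box> cycle_graph n) = {..<m} \<times> {..<n}"
  by (simp add: cartesian_product_def path_graph_def cycle_graph_def)

lemma parcs_cylinder:
  "((i, j), (i', j')) \<in> parcs (path_graph m \<box> cycle_graph n) \<longleftrightarrow>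
    i < m \<and> j < n \<and> i' < m \<and> j' < n \<and>
    (i = i' \<and> (j' = Suc j mod n \<or> j = Suc j' mod n) \<or> j = j' \<and> (i' = Suc i \<or> i = Suc i'))"
  by (auto simp: cartesian_product_def path_graph_def cycle_graph_def)

lemma cylinder_weight:
  "roman_weight (path_graph m \<box> cycle_graph n) f = (\<Sum>i<m. \<Sum>j<n. f (i, j))"
  by (simp add: roman_weight_def sum.cartesian_product)

lemma roman_dominating_value:
  assumes "roman_dominating G f" "v \<in> pverts G"
  shows "f v \<in> {0, 1, 2}"
  using assms unfolding roman_dominating_def by blast

text \<open>With \<open>m \<ge> 8\<close> the four-row strips at the two boundaries are disjoint,
  and all rows between them have nonnegative loss.\<close>

lemma cylinder_weight_lower:
  assumes "m \<ge> 8" "n > 0" and dom: "roman_dominating (path_graph m \<box> cycle_graph n) f"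
  shows "2 * (m + 1) * n \<le> 5 * roman_weight (path_graph m \<box> cycle_graph n) f"
proof -
  define N where "N = int n"
  have N: "N > 0"
    using \<open>n > 0\<close> by (simp add: N_def)
  \<comment> \<open>The guard \<open>i < m\<close> makes row \<open>m\<close> empty, so the last row
    has no neighbour beyond it.\<close>
  define T where "T i j \<longleftrightarrow> i < m \<and> f (i, nat (j mod N)) = 2" for i j
  define S where "S i j \<longleftrightarrow> i < m \<and> f (i, nat (j mod N)) = 1" for i j
  have cover: "cover T S i j \<ge> 1" if "i < m" for i j
  proof -
    define k where "k = nat (j mod N)"
    have k: "int k = j mod N" "k < n"
      using N by (simp_all add: k_def N_def nat_less_iff)
    then have "f (i, k) \<in> {0, 1, 2}"
      using roman_dominating_value[OF dom, of "(i, k)"] that by simp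
    moreover have "T i (j + 1) \<or> T i (j - 1) \<or> T (Suc i) j \<or> 0 < i \<and> T (i - 1) j" if "f (i, k) = 0"
    proof -
      have "(i, k) \<in> pverts (path_graph m \<box> cycle_graph n)"
        using \<open>i < m\<close> k(2) by simp
      then have "\<exists>w. ((i, k), w) \<in> parcs (path_graph m \<box> cycle_graph n) \<and> f w = 2"
        using dom that unfolding roman_dominating_def by blast
      then obtain i' k' where w: "f (i', k') = 2" "((i, k), (i', k')) \<in> parcs (path_graph m \<box> cycle_graph n)"
        by auto
      from w(2) have less: "i' < m" "k' < n"
        by (auto simp: parcs_cylinder)
      from w(2) consider "i = i'" "k' = Suc k mod n" | "i = i'" "k = Suc k' mod n"
        | "k = k'" "i' = Suc i" | "k = k'" "i = Suc i'"
        by (auto simp: parcs_cylinder)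
      then show ?thesis
      proof cases
        case 1
        then have "int k' = (j + 1) mod N"
          using k by (simp add: N_def zmod_int mod_simps add.commute)
        then have "T i (j + 1)"
          using w(1) 1 \<open>i < m\<close> by (simp add: T_def flip: \<open>int k' = _\<close>)
        then show ?thesis by simp
      next
        case 2
        then have "j mod N = (int k' + 1) mod N"
          using k by (simp add: N_def zmod_int add.commute)
        then have "(j - 1) mod N = (int k' + 1 - 1) mod N"
          by (rule mod_diff_cong) simp
        then have "(j - 1) mod N = int k'"
          using less(2) by (simp add: N_def)
        then have "T i (j - 1)"
          using w(1) 2 \<open>i < m\<close> by (simp add: T_def)
        then show ?thesis by simp
      qed (use w(1) less k_def in \<open>auto simp: T_def\<close>)
    qed
    ultimately show ?thesis
      using that by (auto simp: cover_def T_def S_def k_def)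
  qed
  define B where "B i = (\<Sum>j\<in>{0..<N}. of_bool (T i j) :: int)" for i
  define D where "D i = (\<Sum>j\<in>{0..<N}. of_bool (S i j) :: int)" for i
  define L where "L i = (\<Sum>j\<in>{0..<N}. loss T S i j)" for i
  have T_mod: "T i (j mod N) = T i j" and S_mod: "S i (j mod N) = S i j" for i j
    by (simp_all add: T_def S_def)
  \<comment> \<open>A 2 covers three cells of its own row and one in each adjacent row; a value 1
    contributes 3 + 2 = 5.\<close>
  have L: "L i = 5 * D i + 2 * (3 * B i + B (Suc i) + (if 0 < i then B (i - 1) else 0)) - 2 * N" for i
  proof -
    have "(\<Sum>j\<in>{0..<N}. of_bool (T i (j - 1))) = B i" "(\<Sum>j\<in>{0..<N}. of_bool (T i (j + 1))) = B i"
      using sum_periodic_shift[OF N, of "\<lambda>j. of_bool (T i j) :: int" "-1"]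
        sum_periodic_shift[OF N, of "\<lambda>j. of_bool (T i j) :: int" 1]
      by (simp_all add: T_mod B_def)
    moreover have "(\<Sum>j\<in>{0..<N}. of_bool (0 < i \<and> T (i - 1) j)) = (if 0 < i then B (i - 1) else 0)"
      by (simp add: B_def)
    ultimately show ?thesis
      using N unfolding L_def loss_def cover_def
      by (simp only: sum.distrib sum_subtractf flip: sum_distrib_left B_def D_def) simp
  qed
  have L_nonneg: "L i \<ge> 0" if "i < m" for i
    unfolding L_def loss_def using cover[OF that] by (intro sum_nonneg) simp
  have weight: "int (roman_weight (path_graph m \<box> cycle_graph n) f) = (\<Sum>i<m. 2 * B i + D i)"
  proof -
    have "int (\<Sum>k<n. f (i, k)) = 2 * B i + D i" if "i < m" for i
    proof -
      have "int (f (i, nat j)) = 2 * of_bool (T i j) + of_bool (S i j)" if "j \<in> {0..<N}" for j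
      proof -
        have "f (i, nat j) \<in> {0, 1, 2}"
          using roman_dominating_value[OF dom, of "(i, nat j)"] \<open>i < m\<close> that by (auto simp: N_def nat_less_iff)
        then show ?thesis
          using that \<open>i < m\<close> by (auto simp: T_def S_def)
      qed
      then have "(\<Sum>j\<in>{0..<N}. int (f (i, nat j))) = 2 * B i + D i"
        by (simp add: B_def D_def sum.distrib sum_distrib_left)
      then show ?thesis
        using sum_lessThan_int[of "\<lambda>k. int (f (i, k))" n] by (simp add: N_def)
    qed
    then show ?thesis
      by (simp add: cylinder_weight)
  qed
  \<comment> \<open>A 2 in row 0 or \<open>m - 1\<close> covers four cells instead of five; the
    terms in \<open>B\<close> on the left make up for the fifth.\<close>
  have total: "(\<Sum>i<m. L i) + 2 * B 0 + 2 * B (m - 1) = 5 * (\<Sum>i<m. 2 * B i + D i) - 2 * int m * N"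
  proof -
    obtain m' where m': "m = Suc m'"
      using \<open>m \<ge> 8\<close> by (cases m) auto
    have "B m = 0"
      by (simp add: B_def T_def)
    then have "(\<Sum>i<m. B (Suc i)) = (\<Sum>i<m. B i) - B 0"
      using sum.lessThan_Suc_shift[of B m] by simp
    moreover have "(\<Sum>i<m. if 0 < i then B (i - 1) else 0) = (\<Sum>i<m. B i) - B (m - 1)"
      unfolding m' by (subst sum.lessThan_Suc_shift) simp
    moreover have "(\<Sum>i<m. L i) = 5 * (\<Sum>i<m. D i) + 2 * (3 * (\<Sum>i<m. B i) + (\<Sum>i<m. B (Suc i))
        + (\<Sum>i<m. if 0 < i then B (i - 1) else 0)) - 2 * int m * N"
      by (simp add: L sum.distrib sum_subtractf flip: sum_distrib_left)
    moreover have "(\<Sum>i<m. 2 * B i + D i) = 2 * (\<Sum>i<m. B i) + (\<Sum>i<m. D i)"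
      by (simp add: sum.distrib flip: sum_distrib_left)
    ultimately show ?thesis
      by algebra
  qed
  have strip: "N \<le> (\<Sum>i<4. L i) + 2 * B 0"
  proof -
    interpret boundary_strip T S N
      by standard (use N T_mod S_mod cover \<open>m \<ge> 8\<close> in auto)
    show ?thesis
      using strip_loss by (simp add: L_def B_def sum.distrib sum_distrib_left sum.swap[of _ "{..<4}"])
  qed
  have strip': "N \<le> (\<Sum>i<4. L (m - 1 - i)) + 2 * B (m - 1)"
  proof -
    \<comment> \<open>Reversing the order of the rows makes the last row the boundary row 0; the
      empty row \<open>m\<close> plays the part of the missing row above it.\<close>
    let ?T = "\<lambda>i. T (m - 1 - i)" and ?S = "\<lambda>i. S (m - 1 - i)"
    have eq: "cover ?T ?S i j = cover T S (m - 1 - i) j" if "i < 4" for i j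
    proof (cases i)
      case 0
      then show ?thesis
        using \<open>m \<ge> 8\<close> by (simp add: cover_def T_def)
    next
      case (Suc i')
      then have "Suc (m - 1 - i) = m - 1 - i'" "m - 1 - Suc i = m - 1 - i - 1" "0 < m - 1 - i"
        using that \<open>m \<ge> 8\<close> by auto
      then show ?thesis
        using Suc by (simp add: cover_def)
    qed
    interpret boundary_strip ?T ?S N
      by standard (use N T_mod S_mod eq cover \<open>m \<ge> 8\<close> in auto)
    have "(\<Sum>i<4. loss ?T ?S i j) = (\<Sum>i<4. loss T S (m - 1 - i) j)" for j
      by (intro sum.cong refl) (simp only: loss_def eq lessThan_iff)
    then show ?thesis
      using strip_loss by (simp add: L_def B_def sum.distrib sum_distrib_left sum.swap[of _ "{..<4}"])
  qed
  have "inj_on (\<lambda>i. m - 1 - i) {..<4}"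
    using \<open>m \<ge> 8\<close> by (auto simp: inj_on_def)
  from sum.reindex[OF this, of L]
  have "(\<Sum>i<4. L i) + (\<Sum>i<4. L (m - 1 - i)) = (\<Sum>i\<in>{..<4} \<union> (\<lambda>i. m - 1 - i) ` {..<4}. L i)"
    using \<open>m \<ge> 8\<close> by (subst sum.union_disjoint) auto
  also have "\<dots> \<le> (\<Sum>i<m. L i)"
    using \<open>m \<ge> 8\<close> L_nonneg by (intro sum_mono2) auto
  finally have "2 * int m * N + 2 * N \<le> 5 * int (roman_weight (path_graph m \<box> cycle_graph n) f)"
    using strip strip' total weight by linarith
  then have "int (2 * (m + 1) * n) \<le> int (5 * roman_weight (path_graph m \<box> cycle_graph n) f)"
    by (simp add: N_def algebra_simps)
  then show ?thesis
    by (simp only: of_nat_le_iff)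
qed

section \<open>Upper bound from the perfect code\<close>

text \<open>Five consecutive numbers meet each residue class modulo 5 once.\<close>

lemma count_residue_class:
  assumes "d < 5"
  shows "(\<Sum>j<5 * q. of_bool ((j + a) mod 5 = d)) = (q :: nat)"
proof (induction q)
  case (Suc q)
  have consecutive: "of_bool (x mod 5 = d) + of_bool (Suc x mod 5 = d) + of_bool (Suc (Suc x) mod 5 = d)
      + of_bool (Suc (Suc (Suc x)) mod 5 = d) + of_bool (Suc (Suc (Suc (Suc x))) mod 5 = d) = (1 :: nat)" for x
  proof -
    have "x mod 5 \<in> {0, 1, 2, 3, 4}" "d \<in> {0, 1, 2, 3, 4}"
      using assms by auto
    then show ?thesis
      by (auto simp: mod_Suc)
  qed
  have "5 * Suc q = Suc (Suc (Suc (Suc (Suc (5 * q)))))"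
    by simp
  then show ?case
    using Suc consecutive[of "5 * q + a"] by (simp only: sum.lessThan_Suc add_Suc)
qed simp

lemma cylinder_weight_upper:
  assumes "m \<ge> 2" "q > 0"
  obtains f where "roman_dominating (path_graph m \<box> cycle_graph (5 * q)) f"
    and "roman_weight (path_graph m \<box> cycle_graph (5 * q)) f = 2 * (m + 1) * q"
proof
  define r where "r i j = (j + 2 * i) mod 5" for i j :: nat
  \<comment> \<open>Cells with \<open>r\<close> equal to 1, 4, 2, 3 have their code neighbour in
    column \<open>j - 1\<close>, column \<open>j + 1\<close>, row \<open>i - 1\<close>, row
    \<open>i + 1\<close>. Only class 2 in the first row and class 3 in the last row miss it.\<close>
  define f where "f = (\<lambda>(i, j). 2 * of_bool (r i j = 0) + of_bool (i = 0 \<and> r i j = 2)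
    + of_bool (Suc i = m \<and> r i j = 3) :: nat)"
  let ?G = "path_graph m \<box> cycle_graph (5 * q)"
  show "roman_dominating ?G f"
    unfolding roman_dominating_def
  proof (intro conjI ballI impI)
    show "f \<in> pverts ?G \<rightarrow> {0, 1, 2}"
      by (auto simp: f_def of_bool_def split: if_splits)
  next
    fix v assume "v \<in> pverts ?G" and 0: "f v = 0"
    then obtain i j where v: "v = (i, j)" "i < m" "j < 5 * q"
      by auto
    have two: "f (i', j') = 2" if "r i' j' = 0" for i' j'
      using that by (simp add: f_def)
    have "r i j < 5"
      by (simp add: r_def)
    then consider "r i j = 1" | "r i j = 4" | "r i j = 2" "0 < i" | "r i j = 3" "Suc i < m"
      using 0 v by (auto simp: f_def less_Suc_eq numeral_eq_Suc split: if_splits)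
    then have "\<exists>i' j'. r i' j' = 0 \<and> (v, (i', j')) \<in> parcs ?G"
    proof cases
      case 1
      show ?thesis
      proof (cases j)
        case 0
        \<comment> \<open>The code is consistent across the seam because 5 divides the length of the
          cycle.\<close>
        have "r i (5 * q - 1) = 0"
          using 1 0 \<open>q > 0\<close> unfolding r_def by presburger
        then show ?thesis
          using v 0 \<open>q > 0\<close> by (intro exI[of _ i] exI[of _ "5 * q - 1"]) (auto simp: parcs_cylinder)
      next
        case (Suc j')
        have "r i j' = 0"
          using 1 Suc unfolding r_def by presburger
        then show ?thesis
          using v Suc by (intro exI[of _ i] exI[of _ j']) (auto simp: parcs_cylinder)
      qed
    next
      case 2
      have "r i (Suc j mod (5 * q)) = 0"
      proof (cases "Suc j = 5 * q")
        case True
        then show ?thesis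
          using 2 unfolding r_def by simp presburger
      next
        case False
        then have "Suc j mod (5 * q) = Suc j"
          using v by simp
        then show ?thesis
          using 2 by (simp add: r_def mod_Suc)
      qed
      then show ?thesis
        using v \<open>q > 0\<close> by (intro exI[of _ i] exI[of _ "Suc j mod (5 * q)"]) (auto simp: parcs_cylinder)
    next
      case 3
      have "r (i - 1) j = 0"
        using 3 unfolding r_def by presburger
      then show ?thesis
        using v 3 by (intro exI[of _ "i - 1"] exI[of _ j]) (auto simp: parcs_cylinder)
    next
      case 4
      have "r (Suc i) j = 0"
        using 4 unfolding r_def by presburger
      then show ?thesis
        using v 4 by (intro exI[of _ "Suc i"] exI[of _ j]) (auto simp: parcs_cylinder)
    qed
    then show "\<exists>w\<in>pverts ?G. (v, w) \<in> parcs ?G \<and> f w = 2"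
      using two v(1) by (fastforce simp: parcs_cylinder)
  qed
  have row: "(\<Sum>j<5 * q. f (i, j)) = 2 * q + of_bool (i = 0) * q + of_bool (i = m - 1) * q" if "i < m" for i
  proof -
    have "Suc i = m \<longleftrightarrow> i = m - 1"
      using that by auto
    then show ?thesis
      by (simp add: f_def r_def of_bool_conj sum.distrib count_residue_class
          del: sum_of_bool_eq flip: sum_distrib_left)
  qed
  show "roman_weight ?G f = 2 * (m + 1) * q"
    using \<open>m \<ge> 2\<close>
    by (simp add: cylinder_weight row sum.distrib of_bool_def
        flip: sum_distrib_right)
qed

theorem corollary12:
  fixes m n :: nat
  assumes "m \<ge> 10" and "n \<ge> 10" and "n mod 5 = 0"
  shows "real (\<gamma>\<^sub>R (path_graph m \<box> cycle_graph n)) = 2 * (real m + 1) * real n / 5"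
proof -
  let ?G = "path_graph m \<box> cycle_graph n"
  obtain q where q: "n = 5 * q"
    using \<open>n mod 5 = 0\<close> by auto
  obtain f where "roman_dominating ?G f" "roman_weight ?G f = 2 * (m + 1) * q"
    using cylinder_weight_upper[of m q] assms(1,2) q by auto
  then have "\<gamma>\<^sub>R ?G \<le> 2 * (m + 1) * q"
    using roman_domination_number_le by metis
  moreover have "2 * (m + 1) * n \<le> 5 * \<gamma>\<^sub>R ?G"
  proof -
    obtain h where "roman_dominating ?G h" "roman_weight ?G h = \<gamma>\<^sub>R ?G"
      using roman_domination_number_attained by blast
    then show ?thesis
      using cylinder_weight_lower[of m n h] assms(1,2) by simp
  qed
  ultimately have "\<gamma>\<^sub>R ?G = 2 * (m + 1) * q"
    using q by simp
  then show ?thesis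
    using q by (simp add: algebra_simps)
qed

end
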